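(* Let $B$ be a separable real Banach space and let $U:B\to B$ be an invertible linear isometry. Let $(\mathcal F_n)_n$ be a sequence of finite subsets of $B$ such that for every $f\in B$, $$\inf_{g\in V_{\mathcal F_n}}\|g-f\|\xrightarrow[n\to\infty]{}0.$$ Then there exists a family $\mathcal F\subset B$ with $\sharp\mathcal F\leq\sup_n\sharp\mathcal F_n$ and $B=V_{\mathcal F}$.
   Context: For a subset $F\subset B$, $V_F$ denotes the closure of the linear span of $\{U^k x: k\in\mathbb Z,\ x\in F\}$. $\sharp$ denotes cardinality; if $\sup_n\sharp\mathcal F_n=\infty$, the bound $\sharp\mathcal F\le\infty$ imposes no finiteness restriction. *)

theory Defs
  imports "HOL-Analysis.Analysis" "HOL-Library.Extended_Nat"
begin

text \<open>Meaningful only for bijective \<open>U\<close>; for other functions \<open>inv U\<close> is an arbitrary choice.\<close>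

definition int_iterate :: "('a \<Rightarrow> 'a) \<Rightarrow> int \<Rightarrow> 'a \<Rightarrow> 'a" where
  "int_iterate U k = (if 0 \<le> k then U ^^ nat k else inv U ^^ nat (- k))"

definition orbit_span :: "('a::real_normed_vector \<Rightarrow> 'a) \<Rightarrow> 'a set \<Rightarrow> 'a set" where
  "orbit_span U F = closure (span {int_iterate U k x | k x. x \<in> F})"

text \<open>Unlike \<^const>\<open>card\<close>, this does not send infinite sets to \<open>0\<close>; all infinite
  cardinalities are identified with \<open>\<infinity>\<close>.\<close>

definition ecard :: "'a set \<Rightarrow> enat" where
  "ecard A = (if finite A then enat (card A) else \<infinity>)"

end

theory Submission
  imports Defs "HOL-Computational_Algebra.Fundamental_Theorem_Algebra"
begin

text \<open>
  If the bound is infinite, all of \<open>B\<close> works. Otherwise let \<open>q\<close> be the bound and apply the Baire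
  category theorem to sequences in \<open>B\<close>, of which only the first \<open>q\<close> entries matter: it suffices
  that the \<open>q\<close>-tuples whose orbit span comes within \<open>e\<close> of a given \<open>f\<close> form an open dense set. For
  density, approximate a given tuple by elements of \<open>V\<close>, the orbit span of some \<open>z\<^sub>1, \<dots>, z\<^sub>q\<close> that
  also approximates \<open>f\<close>. The tuple is then \<open>P(U) z\<close> for a matrix \<open>P\<close> of real Laurent polynomials, and
  has to be perturbed so that its orbit span contains every \<open>z\<^sub>i\<close>. Gaussian elimination reduces this
  to perturbing a single Laurent polynomial in \<open>U\<close> to an invertible operator preserving all closed
  invariant subspaces. By the factorisation of real polynomials it suffices to treat factors \<open>X - a\<close>
  and \<open>X\<^sup>2 - 2 a X + b\<close>, whose roots are moved off the unit circle by changing the constant term.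
\<close>

section \<open>Operators preserving the closed invariant subspaces\<close>

text \<open>Equality of \<open>W\<close> with its image, not mere inclusion, makes \<open>W\<close>
  invariant under \<open>inv U\<close> as well when \<open>U\<close> is bijective.\<close>

definition reducing :: "('a::real_normed_vector \<Rightarrow> 'a) \<Rightarrow> 'a set \<Rightarrow> bool" where
  "reducing U W \<longleftrightarrow> closed W \<and> subspace W \<and> U ` W = W"

definition preserver :: "('a::real_normed_vector \<Rightarrow> 'a) \<Rightarrow> ('a \<Rightarrow> 'a) \<Rightarrow> bool" where
  "preserver U T \<longleftrightarrow> bounded_linear T \<and> (\<forall>W. reducing U W \<longrightarrow> (\<forall>x\<in>W. T x \<in> W))"

text \<open>Working with images avoids naming an inverse operator. With injectivity,
  \<open>T x\<close> and \<open>x\<close> lie in the same reducing subspaces.\<close>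

definition unit_preserver :: "('a::real_normed_vector \<Rightarrow> 'a) \<Rightarrow> ('a \<Rightarrow> 'a) \<Rightarrow> bool" where
  "unit_preserver U T \<longleftrightarrow> bounded_linear T \<and> inj T \<and> (\<forall>W. reducing U W \<longrightarrow> T ` W = W)"

text \<open>The approximation is pointwise: \<open>T'\<close> may depend on \<open>z\<close>. This
  suffices because the elimination perturbs an operator only at one generator.\<close>

definition unit_limit :: "('a::real_normed_vector \<Rightarrow> 'a) \<Rightarrow> ('a \<Rightarrow> 'a) \<Rightarrow> bool" where
  "unit_limit U T \<longleftrightarrow> preserver U T \<and>
    (\<forall>z e. 0 < e \<longrightarrow> (\<exists>T'. unit_preserver U T' \<and> norm (T' z - T z) < e))"

lemma unit_preserver_imp_preserver: "unit_preserver U T \<Longrightarrow> preserver U T"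
  by (auto simp: unit_preserver_def preserver_def)

lemma linear_preserver: "preserver U T \<Longrightarrow> linear T"
  by (simp add: preserver_def bounded_linear.linear)

lemma linear_unit_preserver: "unit_preserver U T \<Longrightarrow> linear T"
  by (simp add: unit_preserver_def bounded_linear.linear)

lemma unit_preserver_compose:
  assumes "unit_preserver U S" "unit_preserver U T"
  shows "unit_preserver U (\<lambda>x. S (T x))"
proof -
  have "(\<lambda>x. S (T x)) ` W = W" if "reducing U W" for W
    using assms that by (metis image_image unit_preserver_def)
  moreover have "inj (\<lambda>x. S (T x))"
    using assms by (metis (no_types, lifting) injD injI unit_preserver_def)
  ultimately show ?thesis
    using assms by (simp add: unit_preserver_def bounded_linear_compose)
qed

lemma preserver_compose:
  assumes "preserver U S" "preserver U T"
  shows "preserver U (\<lambda>x. S (T x))"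
  using assms by (simp add: preserver_def bounded_linear_compose)

lemma preserver_add:
  assumes "preserver U S" "preserver U T"
  shows "preserver U (\<lambda>x. S x + T x)"
  using assms by (simp add: preserver_def reducing_def bounded_linear_add subspace_add)

lemma preserver_scale:
  assumes "preserver U S"
  shows "preserver U (\<lambda>x. c *\<^sub>R S x)"
  using assms
  by (simp add: preserver_def reducing_def subspace_scale bounded_linear_const_scaleR)

lemma preserver_diff:
  assumes "preserver U S" "preserver U T"
  shows "preserver U (\<lambda>x. S x - T x)"
  using preserver_add[OF assms(1) preserver_scale[OF assms(2), of "-1"]] by simp

lemma preserver_id: "preserver U (\<lambda>x. x)"
  by (auto simp: preserver_def bounded_linear_ident)

lemma unit_preserver_scale:
  assumes "c \<noteq> 0"
  shows "unit_preserver U (\<lambda>x. c *\<^sub>R x)"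
proof -
  have "(\<lambda>x. c *\<^sub>R x) ` W = W" if W: "reducing U W" for W
  proof
    show "(\<lambda>x. c *\<^sub>R x) ` W \<subseteq> W"
      using W by (auto simp: reducing_def subspace_scale)
    show "W \<subseteq> (\<lambda>x. c *\<^sub>R x) ` W"
    proof
      fix w assume "w \<in> W"
      then have "inverse c *\<^sub>R w \<in> W" using W by (auto simp: reducing_def subspace_scale)
      then show "w \<in> (\<lambda>x. c *\<^sub>R x) ` W" using assms by (intro image_eqI[of _ _ "inverse c *\<^sub>R w"]) auto
    qed
  qed
  then show ?thesis
    using assms by (auto simp: unit_preserver_def inj_def bounded_linear_scaleR_right)
qed

text \<open>A factor of an invertible operator is invertible if the two factors commute: injectivity
  is read off from \<open>Q (P x)\<close>, surjectivity on \<open>W\<close> from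
  \<open>P (Q x)\<close>.\<close>

lemma unit_preserver_cancel:
  assumes PQ: "unit_preserver U (\<lambda>x. P (Q x))" and comm: "\<And>x. P (Q x) = Q (P x)"
    and P: "preserver U P" and Q: "preserver U Q"
  shows "unit_preserver U P"
proof -
  have "inj P"
  proof (rule injI)
    fix x y assume "P x = P y"
    then have "P (Q x) = P (Q y)" by (metis comm)
    then show "x = y" using PQ by (simp add: unit_preserver_def inj_eq[of "\<lambda>x. P (Q x)"])
  qed
  moreover have "P ` W = W" if W: "reducing U W" for W
  proof
    show "P ` W \<subseteq> W" using P W by (auto simp: preserver_def)
    have "W = P ` (Q ` W)" using PQ W by (metis image_image unit_preserver_def)
    also have "\<dots> \<subseteq> P ` W" using Q W by (intro image_mono) (auto simp: preserver_def)
    finally show "W \<subseteq> P ` W" .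
  qed
  ultimately show ?thesis using P by (simp add: unit_preserver_def preserver_def)
qed

text \<open>In place of a Neumann series, \<open>x - S x = f\<close> is solved as a fixed point of
  the contraction \<open>f + S x\<close>. For \<open>f\<close> in \<open>W\<close> this map sends
  the complete set \<open>W\<close> to itself, so the solution stays in \<open>W\<close>.\<close>

lemma unit_preserver_id_minus:
  fixes U :: "'a::banach \<Rightarrow> 'a"
  assumes S: "preserver U S" and c: "c < 1" and le: "\<And>x. norm (S x) \<le> c * norm x"
  shows "unit_preserver U (\<lambda>x. x - S x)"
proof -
  have lin: "bounded_linear S" using S by (simp add: preserver_def)
  have ex1: "\<exists>!x\<in>W. f + S x = x" if W: "reducing U W" and f: "f \<in> W" for W f
  \<comment> \<open>The fixed point theorem wants a nonnegative constant, and \<open>c\<close> may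
    be negative.\<close>
  proof (rule Banach_fix[where c = "max 0 c"])
    show "complete W" using W by (simp add: reducing_def complete_eq_closed)
    show "W \<noteq> {}" using f by auto
    show "0 \<le> max 0 c" "max 0 c < 1" using c by auto
    show "(\<lambda>x. f + S x) ` W \<subseteq> W"
      using S W f by (auto simp: preserver_def reducing_def image_subset_iff subspace_add)
    show "dist (f + S x) (f + S y) \<le> max 0 c * dist x y" for x y
    proof -
      have "dist (f + S x) (f + S y) = norm (S (x - y))"
        using lin by (simp add: dist_norm bounded_linear.linear linear_diff)
      also have "\<dots> \<le> c * norm (x - y)" by (rule le)
      also have "\<dots> \<le> max 0 c * norm (x - y)" by (intro mult_right_mono) auto
      finally show ?thesis by (simp add: dist_norm)
    qed
  qed
  have pres: "preserver U (\<lambda>x. x - S x)" by (intro preserver_diff preserver_id S)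
  have "x = y" if "x - S x = y - S y" for x y
  proof -
    have "norm (x - y) = norm (S (x - y))"
    proof -
      have "x - y = S x - S y" using that by (simp add: algebra_simps)
      also have "\<dots> = S (x - y)" using lin by (simp add: bounded_linear.linear linear_diff)
      finally show ?thesis by simp
    qed
    also have "\<dots> \<le> c * norm (x - y)" by (rule le)
    finally have "(1 - c) * norm (x - y) \<le> 0" by (simp add: algebra_simps)
    with c show ?thesis by (simp add: mult_le_0_iff)
  qed
  then have "inj (\<lambda>x. x - S x)" by (intro injI) blast
  moreover have "(\<lambda>x. x - S x) ` W = W" if W: "reducing U W" for W
  proof
    show "(\<lambda>x. x - S x) ` W \<subseteq> W" using pres W by (auto simp: preserver_def)
    show "W \<subseteq> (\<lambda>x. x - S x) ` W"
    proof
      fix f assume "f \<in> W"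
      with ex1[OF W] obtain x where "x \<in> W" "f + S x = x" by blast
      then show "f \<in> (\<lambda>x. x - S x) ` W" by (metis add_diff_cancel_right' image_eqI)
    qed
  qed
  ultimately show ?thesis using pres by (simp add: unit_preserver_def preserver_def)
qed

lemma unit_preserver_imp_limit: "unit_preserver U T \<Longrightarrow> unit_limit U T"
  unfolding unit_limit_def using unit_preserver_imp_preserver by (metis diff_self norm_zero)

text \<open>First \<open>T'\<close> is chosen, using continuity of \<open>S\<close>; then
  \<open>S'\<close> is chosen at the vector \<open>T' z\<close>. Hence no control of operator norms
  is needed.\<close>

lemma unit_limit_compose:
  assumes S: "unit_limit U S" and T: "unit_limit U T"
  shows "unit_limit U (\<lambda>x. S (T x))"
  unfolding unit_limit_def
proof (intro conjI allI impI)
  show "preserver U (\<lambda>x. S (T x))"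
    using assms by (simp add: unit_limit_def preserver_compose)
  fix z and e :: real assume e: "0 < e"
  have "bounded_linear S" using S by (simp add: unit_limit_def preserver_def)
  then have "isCont S (T z)" using linear_continuous_at by blast
  with e obtain d where d: "d > 0" "\<And>y. dist y (T z) < d \<Longrightarrow> dist (S y) (S (T z)) < e/2"
    unfolding continuous_at_eps_delta by (metis half_gt_zero)
  obtain T' where T': "unit_preserver U T'" "norm (T' z - T z) < d"
    using T d(1) unfolding unit_limit_def by blast
  obtain S' where S': "unit_preserver U S'" "norm (S' (T' z) - S (T' z)) < e/2"
    using S e unfolding unit_limit_def by (meson half_gt_zero)
  have "norm (S (T' z) - S (T z)) < e/2"
    using d(2)[of "T' z"] T'(2) by (simp add: dist_norm)
  then have "norm (S' (T' z) - S (T z)) < e"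
    using S'(2) norm_triangle_lt[of "S' (T' z) - S (T' z)" "S (T' z) - S (T z)" e] by simp
  then show "\<exists>V. unit_preserver U V \<and> norm (V z - S (T z)) < e"
    using unit_preserver_compose[OF S'(1) T'(1)] by blast
qed

section \<open>Polynomials in an operator\<close>

text \<open>Horner's scheme for \<open>p(U) x\<close>. It makes sense in any real vector space, so
  it also covers multiplication by a complex number.\<close>

definition poly_op :: "('a::real_vector \<Rightarrow> 'a) \<Rightarrow> real poly \<Rightarrow> 'a \<Rightarrow> 'a" where
  "poly_op U p x = fold_coeffs (\<lambda>a y. a *\<^sub>R x + U y) p 0"

lemma poly_op_0 [simp]: "poly_op U 0 x = 0"
  by (simp add: poly_op_def)

lemma poly_op_pCons [simp]:
  assumes "linear U"
  shows "poly_op U (pCons a p) x = a *\<^sub>R x + U (poly_op U p x)"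
  using assms by (cases "a = 0 \<and> p = 0") (auto simp: poly_op_def linear_0)

lemma linear_poly_op:
  assumes "linear U"
  shows "linear (poly_op U p)"
proof (induction p)
  case 0
  have "poly_op U 0 = (\<lambda>x. 0)" by auto
  then show ?case by (simp add: linear_zero)
next
  case (pCons a p)
  have "poly_op U (pCons a p) = (\<lambda>x. a *\<^sub>R x + U (poly_op U p x))" using assms by auto
  moreover have "linear (\<lambda>x. U (poly_op U p x))"
    using linear_compose[OF pCons.IH assms] by (simp add: o_def)
  ultimately show ?case
    by (simp add: linear_compose_add linear_compose_scale_right linear_id[unfolded id_def])
qed

lemma poly_op_add:
  assumes "linear U"
  shows "poly_op U (p + q) x = poly_op U p x + poly_op U q x"
  using assms by (induction p q rule: poly_induct2) (auto simp: linear_add algebra_simps)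

lemma poly_op_smult:
  assumes "linear U"
  shows "poly_op U (smult c p) x = c *\<^sub>R poly_op U p x"
  using assms by (induction p) (auto simp: linear_scale algebra_simps)

lemma poly_op_mult:
  assumes "linear U"
  shows "poly_op U (p * q) x = poly_op U p (poly_op U q x)"
  using assms by (induction p) (auto simp: poly_op_add poly_op_smult)

lemma poly_op_monom:
  assumes "linear U"
  shows "poly_op U (monom c n) x = c *\<^sub>R (U ^^ n) x"
  using assms by (induction n) (auto simp: monom_0 monom_Suc linear_scale linear_0)

section \<open>Real polynomials and their complex roots\<close>

lemma poly_op_complex:
  "poly_op (\<lambda>x. z * x) p w = poly (map_poly complex_of_real p) z * w"
proof -
  have "linear (\<lambda>x. z * x)" by (simp add: bounded_linear.linear bounded_linear_mult_right)
  then show ?thesis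
    by (induction p) (simp_all add: map_poly_pCons scaleR_conv_of_real algebra_simps)
qed

text \<open>A complex root \<open>z\<close> exists. If it is real, it gives a linear factor.
  Otherwise \<open>m\<close>, the product of \<open>X - z\<close> and its conjugate, divides
  \<open>p\<close>: the remainder \<open>c + d X\<close> vanishes at the non-real \<open>z\<close>,
  so \<open>c = d = 0\<close>. The condition \<open>a\<^sup>2 < b\<close> says that the roots of
  \<open>m\<close> are not real.\<close>

lemma real_poly_factor:
  fixes p :: "real poly"
  assumes "degree p > 0"
  shows "(\<exists>a q. p = [:-a, 1:] * q) \<or> (\<exists>a b q. a\<^sup>2 < b \<and> p = [:b, -2*a, 1:] * q)"
proof -
  define P where "P = map_poly complex_of_real p"
  have "\<not> constant (poly P)"
    using assms by (simp add: constant_degree P_def degree_map_poly)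
  then obtain z where z: "poly P z = 0" using fundamental_theorem_of_algebra by blast
  define ev where "ev q = poly_op (\<lambda>x. z * x) q 1" for q
  have lin: "linear (\<lambda>x. z * x)"
    by (simp add: bounded_linear.linear bounded_linear_mult_right)
  have ev: "ev p = 0" using z by (simp add: ev_def poly_op_complex P_def)
  show ?thesis
  proof (cases "Im z = 0")
    case True
    then have "z = of_real (Re z)" by (simp add: complex_eq_iff)
    then have *: "z * x = Re z *\<^sub>R x" for x by (metis scaleR_conv_of_real)
    have "ev q = of_real (poly q (Re z))" for q
      unfolding ev_def
      by (induction q) (simp_all add: lin, simp add: * scaleR_conv_of_real)
    with ev have "poly p (Re z) = 0" by simp
    then show ?thesis by (metis dvdE poly_eq_0_iff_dvd)
  next
    case False
    define a b where "a = Re z" and "b = (Re z)\<^sup>2 + (Im z)\<^sup>2"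
    define m where "m = [:b, -2*a, 1:]"
    have m0: "poly_op (\<lambda>x. z * x) m 1 = 0"
      by (simp add: m_def lin)
        (simp add: a_def b_def complex_eq_iff power2_eq_square algebra_simps)
    have "ev p = ev ((p div m) * m + p mod m)" by simp
    also have "\<dots> = ev (p mod m)"
      unfolding ev_def by (simp only: poly_op_add[OF lin] poly_op_mult[OF lin] m0)
        (simp add: linear_0[OF linear_poly_op[OF lin]])
    finally have r0: "ev (p mod m) = 0" using ev by simp
    have "degree (p mod m) < 2"
      using degree_mod_less[of m p] by (auto simp: m_def)
    then have "p mod m = [:coeff (p mod m) 0, coeff (p mod m) 1:]"
      by (intro poly_eqI) (auto simp: coeff_pCons coeff_eq_0 split: nat.splits)
    then obtain c d where cd: "p mod m = [:c, d:]" by blast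
    have "of_real c + z * of_real d = 0"
      using r0 by (simp add: cd ev_def lin scaleR_conv_of_real)
    then have "d = 0" "c = 0" using False by (auto simp: complex_eq_iff)
    then have "p = m * (p div m)" using cd by (metis add.right_neutral mult_div_mod_eq pCons_0_0)
    moreover have "a\<^sup>2 < b" using False by (simp add: a_def b_def)
    ultimately show ?thesis unfolding m_def by blast
  qed
qed

section \<open>Polynomials in an invertible isometry\<close>

locale invertible_isometry =
  fixes U :: "'b::banach \<Rightarrow> 'b"
  assumes linear: "linear U" and bij: "bij U" and norm_eq: "norm (U x) = norm x"
begin

lemma U_inv [simp]: "U (inv U x) = x" and inv_U [simp]: "inv U (U x) = x"
  using bij by (simp_all add: bij_is_surj surj_f_inv_f bij_is_inj)

lemma inverse_isometry: "invertible_isometry (inv U)"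
proof (rule invertible_isometry.intro)
  show "linear (inv U)"
  proof (rule linearI)
    show "inv U (x + y) = inv U x + inv U y" for x y
      by (metis linear_add[OF linear] U_inv inv_U)
    show "inv U (r *\<^sub>R x) = r *\<^sub>R inv U x" for r x
      by (metis linear_scale[OF linear] U_inv inv_U)
  qed
  show "bij (inv U)" using bij by (rule bij_imp_bij_inv)
  show "norm (inv U x) = norm x" for x by (metis norm_eq U_inv)
qed

lemma linear_inv: "linear (inv U)"
  using inverse_isometry by (rule invertible_isometry.linear)

lemma norm_inv: "norm (inv U x) = norm x"
  using inverse_isometry by (rule invertible_isometry.norm_eq)

lemma bounded_linear_U: "bounded_linear U"
  using linear norm_eq by (intro bounded_linear_intro[where K = 1]) (auto simp: linear_add linear_scale)

lemma reducing_inv: "reducing (inv U) W \<longleftrightarrow> reducing U W"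
  unfolding reducing_def by (metis bij bij_is_inj bij_is_surj image_f_inv_f image_inv_f_f)

lemma unit_preserver_inv_iff: "unit_preserver (inv U) T \<longleftrightarrow> unit_preserver U T"
  by (simp add: unit_preserver_def reducing_inv)

lemma unit_preserver_U: "unit_preserver U U"
  using bounded_linear_U bij by (auto simp: unit_preserver_def reducing_def bij_is_inj)

lemma unit_preserver_funpow: "unit_preserver U (U ^^ n)"
proof (induction n)
  case 0
  then show ?case using unit_preserver_scale[of 1 U] by (simp add: id_def)
next
  case (Suc n)
  then show ?case
    using unit_preserver_compose[OF unit_preserver_U Suc] by (simp add: o_def)
qed

lemma unit_preserver_inv_funpow: "unit_preserver U (inv U ^^ n)"
  using invertible_isometry.unit_preserver_funpow[OF inverse_isometry] unit_preserver_inv_iff by blast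

lemma norm_inv_funpow: "norm ((inv U ^^ n) x) = norm x"
  by (induction n) (auto simp: norm_inv)

lemma inv_funpow_U [simp]: "(inv U ^^ n) ((U ^^ n) x) = x"
  by (induction n arbitrary: x) (auto simp: funpow_swap1)

lemma U_funpow_inv [simp]: "(U ^^ n) ((inv U ^^ n) x) = x"
  by (induction n arbitrary: x) (auto simp: funpow_swap1)

lemma preserver_poly_op: "preserver U (poly_op U p)"
proof (induction p)
  case 0
  have "poly_op U 0 = (\<lambda>x. 0 *\<^sub>R x)" by auto
  then show ?case using preserver_scale[OF preserver_id, of U 0] by simp
next
  case (pCons a p)
  have "poly_op U (pCons a p) = (\<lambda>x. a *\<^sub>R x + U (poly_op U p x))" using linear by auto
  then show ?case
    using preserver_add[OF preserver_scale[OF preserver_id]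
        preserver_compose[OF unit_preserver_imp_preserver[OF unit_preserver_U] pCons.IH]] by simp
qed

section \<open>Invertibility when the roots avoid the unit circle\<close>

text \<open>Factor out \<open>U ^^ n\<close>: what remains is the identity minus
  \<open>inv U ^^ n\<close> after \<open>S\<close>, and \<open>inv U ^^ n\<close> is isometric, so
  the bound on \<open>S\<close> is kept.\<close>

lemma unit_preserver_dominant_monom:
  assumes S: "preserver U S" and c: "c < 1" and le: "\<And>x. norm (S x) \<le> c * norm x"
  shows "unit_preserver U (\<lambda>x. (U ^^ n) x - S x)"
proof -
  have inv: "preserver U (inv U ^^ n)"
    by (intro unit_preserver_imp_preserver unit_preserver_inv_funpow)
  have "unit_preserver U (\<lambda>x. x - (inv U ^^ n) (S x))"
    using c le by (intro unit_preserver_id_minus[of U _ c] preserver_compose[OF inv S])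
      (auto simp: norm_inv_funpow)
  from unit_preserver_compose[OF unit_preserver_funpow this]
  have "unit_preserver U (\<lambda>x. (U ^^ n) (x - (inv U ^^ n) (S x)))" .
  moreover have "linear (U ^^ n)"
    using unit_preserver_funpow by (simp add: unit_preserver_def bounded_linear.linear)
  ultimately show ?thesis by (simp add: linear_diff)
qed

text \<open>For a root inside the unit circle \<open>U\<close> dominates; for one outside, the
  constant term does, after factoring out \<open>-a\<close>.\<close>

lemma unit_preserver_linear_poly:
  assumes "\<bar>a\<bar> \<noteq> 1"
  shows "unit_preserver U (poly_op U [:-a, 1:])"
proof (cases "\<bar>a\<bar> < 1")
  case True
  then have "unit_preserver U (\<lambda>x. U x - a *\<^sub>R x)"
    using unit_preserver_dominant_monom[OF preserver_scale[OF preserver_id, of U a], of "\<bar>a\<bar>" 1]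
    by simp
  moreover have "(\<lambda>x. U x - a *\<^sub>R x) = poly_op U [:-a, 1:]"
    using linear by (auto simp: fun_eq_iff linear_0)
  ultimately show ?thesis by simp
next
  case False
  with assms have a: "\<bar>a\<bar> > 1" by simp
  then have "unit_preserver U (\<lambda>x. x - inverse a *\<^sub>R U x)"
    using unit_preserver_imp_preserver[OF unit_preserver_U]
    by (intro unit_preserver_id_minus[of U _ "inverse \<bar>a\<bar>"] preserver_scale)
      (auto simp: norm_eq inverse_less_1_iff)
  from unit_preserver_compose[OF unit_preserver_scale[of "-a"] this] a
  have "unit_preserver U (\<lambda>x. (-a) *\<^sub>R (x - inverse a *\<^sub>R U x))" by auto
  moreover have "(\<lambda>x. (-a) *\<^sub>R (x - inverse a *\<^sub>R U x)) = poly_op U [:-a, 1:]"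
    using a linear by (auto simp: fun_eq_iff algebra_simps linear_0)
  ultimately show ?thesis by simp
qed

text \<open>Modulo \<open>m = X\<^sup>2 - 2 a X + b\<close> every power of \<open>X\<close> is a linear polynomial. For roots inside the unit
  circle its coefficients tend to \<open>0\<close>, so a multiple of \<open>m\<close> is a small perturbation of a power.\<close>

lemma quadratic_telescope:
  fixes a b :: real and c :: "nat \<Rightarrow> real"
  assumes "c 0 = 1" "c 1 = 2 * a" "\<And>n. c (n + 2) = 2 * a * c (n + 1) - b * c n"
  shows "\<exists>q. q * [:b, -2*a, 1:] = monom 1 (n + 2) - [:- b * c n, c (n + 1):]"
proof (induction n)
  case 0
  show ?case using assms(1,2) by (intro exI[of _ 1]) (simp add: monom_Suc monom_0 numeral_2_eq_2)
next
  case (Suc n)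
  then obtain q where q: "q * [:b, -2*a, 1:] = monom 1 (n + 2) - [:- b * c n, c (n + 1):]" by blast
  have "pCons (c (n + 1)) q * [:b, -2*a, 1:] =
      smult (c (n + 1)) [:b, -2*a, 1:] + pCons 0 (q * [:b, -2*a, 1:])" by simp
  also have "\<dots> = monom 1 (Suc n + 2) - [:- b * c (Suc n), c (Suc n + 1):]"
    using assms(3)[of n] unfolding q by (simp add: monom_Suc)
  finally show ?case by blast
qed

lemma unit_preserver_quadratic_lt:
  assumes ab: "a\<^sup>2 < b" and b: "b < 1"
  shows "unit_preserver U (poly_op U [:b, -2*a, 1:])"
proof -
  \<comment> \<open>A root of the quadratic; its modulus is the square root of
    \<open>b\<close>.\<close>
  define z where "z = Complex a (sqrt (b - a\<^sup>2))"
  have im: "Im z > 0" using ab by (simp add: z_def)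
  have "0 < b" using ab zero_le_power2[of a] by linarith
  then have z1: "cmod z < 1" using ab b by (simp add: z_def cmod_def)
  \<comment> \<open>The closed form of the recurrence in \<open>quadratic_telescope\<close>: the
    quotient of \<open>z ^ Suc n - cnj z ^ Suc n\<close> by \<open>z - cnj z\<close>.\<close>
  define c where "c n = Im (z ^ Suc n) / Im z" for n
  have zz: "z\<^sup>2 = 2 * of_real a * z - of_real b"
    using ab by (simp add: z_def complex_eq_iff power2_eq_square)
  have c0: "c 0 = 1" using im by (simp add: c_def)
  have c1: "c 1 = 2 * a" using im by (simp add: c_def z_def power2_eq_square)
  have cn: "c (n + 2) = 2 * a * c (n + 1) - b * c n" for n
  proof -
    have "z ^ Suc (n + 2) = z ^ Suc n * z\<^sup>2" by (simp add: power2_eq_square)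
    also have "\<dots> = of_real (2 * a) * z ^ Suc (n + 1) - of_real b * z ^ Suc n"
      unfolding zz by (simp add: algebra_simps)
    finally have "Im (z ^ Suc (n + 2)) = 2 * a * Im (z ^ Suc (n + 1)) - b * Im (z ^ Suc n)"
      by (metis Im_complex_of_real Re_complex_of_real minus_complex.simps(2) times_complex.simps(2)
          mult_zero_left add_0_right)
    then show ?thesis unfolding c_def by (simp add: diff_divide_distrib)
  qed
  have lim: "c \<longlonglongrightarrow> 0"
  proof -
    have "(\<lambda>n. z ^ n) \<longlonglongrightarrow> 0" using z1 by (rule LIMSEQ_power_zero)
    then have "(\<lambda>n. Im (z ^ Suc n)) \<longlonglongrightarrow> Im 0" by (intro tendsto_Im LIMSEQ_Suc)
    then have "(\<lambda>n. Im (z ^ Suc n) / Im z) \<longlonglongrightarrow> 0 / Im z"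
      using im by (intro tendsto_divide) auto
    then show ?thesis by (simp add: c_def[abs_def])
  qed
  have "(\<lambda>n. \<bar>b * c n\<bar> + \<bar>c (n + 1)\<bar>) \<longlonglongrightarrow> \<bar>b * 0\<bar> + \<bar>0\<bar>"
    using LIMSEQ_Suc[OF lim] by (intro tendsto_intros lim) simp
  then have "\<forall>\<^sub>F n in sequentially. \<bar>b * c n\<bar> + \<bar>c (n + 1)\<bar> < 1"
    by (intro order_tendstoD(2)[where y = 0]) auto
  then obtain n where n: "\<bar>b * c n\<bar> + \<bar>c (n + 1)\<bar> < 1"
    by (meson eventually_sequentially order_refl)
  obtain q where q: "q * [:b, -2*a, 1:] = monom 1 (n + 2) - [:- b * c n, c (n + 1):]"
    using quadratic_telescope[of c a b n] c0 c1 cn by blast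
  let ?p = "[:b, -2*a, 1:]"
  define S where "S = poly_op U [:- b * c n, c (n + 1):]"
  have "norm (S x) \<le> (\<bar>b * c n\<bar> + \<bar>c (n + 1)\<bar>) * norm x" for x
  proof -
    have "S x = (- b * c n) *\<^sub>R x + c (n + 1) *\<^sub>R U x"
      using linear by (simp add: S_def linear_0 linear_scale)
    also have "norm \<dots> \<le> \<bar>b * c n\<bar> * norm x + \<bar>c (n + 1)\<bar> * norm x"
      by (rule order_trans[OF norm_triangle_ineq]) (simp add: norm_eq abs_mult)
    finally show ?thesis by (simp add: algebra_simps)
  qed
  then have "unit_preserver U (\<lambda>x. (U ^^ (n + 2)) x - S x)"
    using n by (intro unit_preserver_dominant_monom) (auto simp: S_def preserver_poly_op)
  moreover have "(U ^^ (n + 2)) x - S x = poly_op U (q * ?p) x" for x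
  proof -
    have "poly_op U (q * ?p) x + S x = poly_op U (q * ?p + [:- b * c n, c (n + 1):]) x"
      unfolding S_def by (rule poly_op_add[OF linear, symmetric])
    also have "\<dots> = (U ^^ (n + 2)) x"
      unfolding q by (simp only: diff_add_cancel poly_op_monom[OF linear] scaleR_one)
    finally show ?thesis by (simp only: diff_eq_eq)
  qed
  ultimately have "unit_preserver U (\<lambda>x. poly_op U (?p * q) x)"
    by (simp only: mult.commute)
  then have "unit_preserver U (\<lambda>x. poly_op U ?p (poly_op U q x))"
    by (simp only: poly_op_mult[OF linear])
  \<comment> \<open>The multiple \<open>?p * q\<close> is invertible, and polynomials in
    \<open>U\<close> commute, so the factor \<open>?p\<close> is invertible.\<close>
  then show ?thesis
    by (rule unit_preserver_cancel)
      (simp_all only: poly_op_mult[OF linear, symmetric] mult.commute preserver_poly_op)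
qed

text \<open>Roots outside the circle are inverted: up to the factor \<open>b\<close> and the
  invertible \<open>U ^^ 2\<close>, the operator is the reciprocal polynomial evaluated at
  \<open>inv U\<close>.\<close>

lemma unit_preserver_quadratic:
  assumes ab: "a\<^sup>2 < b" and b: "b \<noteq> 1"
  shows "unit_preserver U (poly_op U [:b, -2*a, 1:])"
proof (cases "b < 1")
  case True
  with ab show ?thesis by (rule unit_preserver_quadratic_lt)
next
  case False
  with b have b1: "b > 1" by simp
  let ?T = "poly_op (inv U) [:1/b, -2*(a/b), 1:]"
  have "(a / b)\<^sup>2 < 1 / b" using ab b1 by (simp add: power2_eq_square field_simps)
  then have "unit_preserver U ?T"
    using b1 invertible_isometry.unit_preserver_quadratic_lt[OF inverse_isometry, of "a/b" "1/b"]
    by (simp only: unit_preserver_inv_iff) simp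
  from unit_preserver_compose[OF unit_preserver_scale[of b]
      unit_preserver_compose[OF this unit_preserver_funpow[of 2]]] b1
  have "unit_preserver U (\<lambda>x. b *\<^sub>R ?T ((U ^^ 2) x))" by auto
  moreover have "b *\<^sub>R ?T ((U ^^ 2) x) = poly_op U [:b, -2*a, 1:] x" for x
    using b1 linear linear_inv
    by (simp add: numeral_2_eq_2 linear_0 linear_diff[OF linear] linear_diff[OF linear_inv]
        linear_scale[OF linear] linear_scale[OF linear_inv] algebra_simps)
  ultimately show ?thesis by simp
qed

section \<open>Perturbing polynomials to invertible operators\<close>

text \<open>Raising the constant coefficient by \<open>t\<close> moves the value at \<open>z\<close>
  by \<open>t *\<^sub>R z\<close>, and arbitrarily small positive \<open>t\<close> avoid the finite
  set \<open>A\<close>. Taking \<open>t\<close> positive preserves \<open>a\<^sup>2 < b\<close> for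
  quadratic factors.\<close>

lemma unit_limit_pCons:
  assumes "finite A"
    and unit: "\<And>t. 0 < t \<Longrightarrow> t \<notin> A \<Longrightarrow> unit_preserver U (poly_op U (pCons (c + t) q))"
  shows "unit_limit U (poly_op U (pCons c q))"
  unfolding unit_limit_def
proof (intro conjI allI impI)
  show "preserver U (poly_op U (pCons c q))" by (rule preserver_poly_op)
  fix z :: 'b and e :: real assume e: "0 < e"
  \<comment> \<open>The added 1 keeps the denominator positive when \<open>z = 0\<close>.\<close>
  define d where "d = e / (norm z + 1)"
  have n: "norm z + 1 > 0" by (rule add_nonneg_pos) auto
  have d: "d > 0" using e n by (simp add: d_def)
  have dz: "d * norm z < e" using e n by (simp add: d_def divide_less_eq algebra_simps)
  have "infinite ({0<..d} - A)" using d assms(1) by (simp add: infinite_Ioc)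
  then obtain t where t: "0 < t" "t \<le> d" "t \<notin> A"
    by (metis DiffD1 DiffD2 equals0I finite.emptyI greaterThanAtMost_iff)
  have "poly_op U (pCons (c + t) q) z - poly_op U (pCons c q) z = t *\<^sub>R z"
    using linear by (simp add: algebra_simps)
  moreover have "t * norm z \<le> d * norm z" using t by (intro mult_right_mono) auto
  ultimately have "norm (poly_op U (pCons (c + t) q) z - poly_op U (pCons c q) z) < e"
    using dz t by simp
  then show "\<exists>T'. unit_preserver U T' \<and> norm (T' z - poly_op U (pCons c q) z) < e"
    using unit[OF t(1,3)] by blast
qed

text \<open>Induction on the degree: split off an irreducible factor, perturb it alone, and compose.
  The zero polynomial falls under the constant case.\<close>

lemma unit_limit_poly_op: "unit_limit U (poly_op U p)"
proof (induction "degree p" arbitrary: p rule: less_induct)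
  case less
  have split: "unit_limit U (poly_op U p)"
    if "p = m * q" "unit_limit U (poly_op U m)" "degree m > 0" "p \<noteq> 0" for m q
  proof -
    have "m \<noteq> 0" "q \<noteq> 0" using that(1,4) by auto
    then have "degree q < degree p" unfolding that(1) using that(3) by (simp add: degree_mult_eq)
    then have "unit_limit U (poly_op U q)" by (rule less)
    with that(2) have "unit_limit U (\<lambda>x. poly_op U m (poly_op U q x))"
      by (rule unit_limit_compose)
    moreover have "poly_op U p = (\<lambda>x. poly_op U m (poly_op U q x))"
      by (simp add: that(1) poly_op_mult[OF linear] fun_eq_iff)
    ultimately show ?thesis by simp
  qed
  show ?case
  proof (cases "degree p = 0")
    case True
    then obtain c where p: "p = [:c:]" by (meson degree_eq_zeroE)
    have "poly_op U [:a:] = (\<lambda>x. a *\<^sub>R x)" for a using linear by (simp add: linear_0 fun_eq_iff)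
    then have "unit_preserver U (poly_op U [:c + t:])" if "t \<notin> {-c}" for t
      using that unit_preserver_scale[of "c + t" U] by auto
    then show ?thesis unfolding p by (intro unit_limit_pCons[of "{-c}"]) auto
  next
    case False
    then have "degree p > 0" "p \<noteq> 0" by auto
    from real_poly_factor[OF this(1)] show ?thesis
    proof (elim disjE exE conjE)
      fix a q assume p: "p = [:-a, 1:] * q"
      \<comment> \<open>The excluded \<open>t\<close> are those that put the root
        \<open>a - t\<close> at 1 or -1.\<close>
      have "unit_preserver U (poly_op U [:-a + t, 1:])" if "t \<notin> {a - 1, a + 1}" for t
        using that unit_preserver_linear_poly[of "a - t"] by auto
      then have "unit_limit U (poly_op U [:-a, 1:])"
        by (intro unit_limit_pCons[of "{a - 1, a + 1}"]) auto
      then show ?thesis using split[OF p] \<open>p \<noteq> 0\<close> by simp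
    next
      fix a b q assume ab: "a\<^sup>2 < b" and p: "p = [:b, -2*a, 1:] * q"
      \<comment> \<open>Here \<open>b + t\<close> is the squared modulus of the two roots, so only
        the value 1 is excluded.\<close>
      have "unit_preserver U (poly_op U [:b + t, -2*a, 1:])" if "0 < t" "t \<notin> {1 - b}" for t
        using that ab by (intro unit_preserver_quadratic) auto
      then have "unit_limit U (poly_op U [:b, -2*a, 1:])"
        by (intro unit_limit_pCons[of "{1 - b}"]) auto
      then show ?thesis using split[OF p] \<open>p \<noteq> 0\<close> by simp
    qed
  qed
qed

end

section \<open>Orbit spans\<close>

lemma subspace_closure:
  fixes S :: "'a::real_normed_vector set"
  assumes "subspace S"
  shows "subspace (closure S)"
proof (rule subspaceI)
  show "0 \<in> closure S" using assms closure_subset subspace_0 by blast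
next
  fix x y assume "x \<in> closure S" "y \<in> closure S"
  then obtain X Y where "\<And>n. X n \<in> S" "X \<longlonglongrightarrow> x" "\<And>n. Y n \<in> S" "Y \<longlonglongrightarrow> y"
    unfolding closure_sequential by blast
  then have "\<forall>n. X n + Y n \<in> S" "(\<lambda>n. X n + Y n) \<longlonglongrightarrow> x + y"
    using assms by (simp_all add: subspace_add tendsto_add)
  then show "x + y \<in> closure S"
    unfolding closure_sequential by (intro exI[of _ "\<lambda>n. X n + Y n"] conjI)
next
  fix c x assume "x \<in> closure S"
  then obtain X where "\<And>n. X n \<in> S" "X \<longlonglongrightarrow> x" unfolding closure_sequential by blast
  then have "\<forall>n. c *\<^sub>R X n \<in> S" "(\<lambda>n. c *\<^sub>R X n) \<longlonglongrightarrow> c *\<^sub>R x"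
    using assms by (simp_all add: subspace_scale tendsto_scaleR)
  then show "c *\<^sub>R x \<in> closure S"
    unfolding closure_sequential by (intro exI[of _ "\<lambda>n. c *\<^sub>R X n"] conjI)
qed

context invertible_isometry
begin

lemma int_iterate_Suc: "U (int_iterate U k x) = int_iterate U (k + 1) x"
proof (cases "0 \<le> k")
  case True
  then show ?thesis by (simp add: int_iterate_def nat_add_distrib)
next
  case False
  then obtain m where "nat (- k) = Suc m" "nat (- (k + 1)) = m" by (cases "nat (- k)") auto
  then show ?thesis using False by (auto simp: int_iterate_def)
qed

lemma orbit_span_superset: "F \<subseteq> orbit_span U F"
proof
  fix x assume "x \<in> F"
  moreover have "x = int_iterate U 0 x" by (simp add: int_iterate_def)
  ultimately have "x \<in> {int_iterate U k x |k x. x \<in> F}" by blast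
  then show "x \<in> orbit_span U F"
    unfolding orbit_span_def by (meson closure_subset span_base subsetD)
qed

text \<open>\<open>U\<close> and \<open>inv U\<close> map the set of orbits into itself; linearity
  carries this to the span and continuity to the closure.\<close>

lemma reducing_orbit_span: "reducing U (orbit_span U F)"
proof -
  let ?G = "{int_iterate U k x |k x. x \<in> F}"
  have inv_int_iterate: "inv U (int_iterate U k x) = int_iterate U (k - 1) x" for k x
    using int_iterate_Suc[of "k - 1" x] by (metis diff_add_cancel inv_U)
  have image: "V ` closure (span ?G) \<subseteq> closure (span ?G)"
    if V: "bounded_linear V" and G: "V ` ?G \<subseteq> ?G" for V
  proof -
    have "V ` span ?G = span (V ` ?G)"
      using V by (simp add: bounded_linear.linear linear_span_image)
    then have "V ` span ?G \<subseteq> closure (span ?G)"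
      using span_mono[OF G] closure_subset by blast
    then show ?thesis
      using V by (intro image_closure_subset linear_continuous_on) auto
  qed
  have "U ` ?G \<subseteq> ?G" using int_iterate_Suc by blast
  then have sub: "U ` orbit_span U F \<subseteq> orbit_span U F"
    unfolding orbit_span_def by (intro image bounded_linear_U)
  have "inv U ` ?G \<subseteq> ?G" using inv_int_iterate by blast
  then have "inv U ` orbit_span U F \<subseteq> orbit_span U F"
    unfolding orbit_span_def
    by (intro image invertible_isometry.bounded_linear_U[OF inverse_isometry])
  then have "orbit_span U F \<subseteq> U ` orbit_span U F"
    by (metis U_inv image_eqI image_subset_iff subsetI)
  with sub show ?thesis
    unfolding reducing_def by (simp add: orbit_span_def subspace_closure)
qed

text \<open>With \<open>reducing_orbit_span\<close>, this makes the orbit span the least reducing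
  subspace containing \<open>F\<close>, so inclusions can be checked on generators.\<close>

lemma orbit_span_minimal:
  assumes W: "reducing U W" and "F \<subseteq> W"
  shows "orbit_span U F \<subseteq> W"
proof -
  have "(U ^^ n) x \<in> W" "(inv U ^^ n) x \<in> W" if "x \<in> W" for n x
    using that W unit_preserver_funpow[of n] unit_preserver_inv_funpow[of n]
    unfolding unit_preserver_def by blast+
  then have "{int_iterate U k x |k x. x \<in> F} \<subseteq> W"
    using assms(2) by (auto simp: int_iterate_def)
  then show ?thesis
    using W unfolding orbit_span_def reducing_def by (intro closure_minimal span_minimal) auto
qed

lemma orbit_span_subset: "F \<subseteq> orbit_span U G \<Longrightarrow> orbit_span U F \<subseteq> orbit_span U G"
  by (intro orbit_span_minimal reducing_orbit_span)

lemma preserver_orbit_span: "preserver U T \<Longrightarrow> x \<in> orbit_span U F \<Longrightarrow> T x \<in> orbit_span U F"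
  using reducing_orbit_span by (auto simp: preserver_def)

lemma subspace_orbit_span: "subspace (orbit_span U F)"
  using reducing_orbit_span by (auto simp: reducing_def)

section \<open>Isolating one generator\<close>

text \<open>The contribution of \<open>z\<close> is a Laurent polynomial in \<open>U\<close>,
  written as an ordinary polynomial over the common denominator \<open>U ^^ n\<close>.\<close>

lemma span_orbits_insert:
  assumes "y \<in> span {int_iterate U k x |k x. x \<in> insert z F}"
  shows "\<exists>n p. \<exists>w\<in>orbit_span U F. y = (inv U ^^ n) (poly_op U p z) + w"
  using assms
proof (induction rule: span_induct_alt)
  case base
  have "0 \<in> orbit_span U F" by (rule subspace_0[OF subspace_orbit_span])
  then show ?case by (intro exI[of _ 0] bexI[of _ 0]) auto
next
  case (step c x y)
  note lin = linear_unit_preserver[OF unit_preserver_inv_funpow]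
  obtain n p w where y: "w \<in> orbit_span U F" "y = (inv U ^^ n) (poly_op U p z) + w"
    using step by blast
  obtain k x' where x: "x = int_iterate U k x'" "x' \<in> insert z F" using step by blast
  show ?case
  proof (cases "x' = z")
    case True
    \<comment> \<open>One of the two exponents is 0, and \<open>k = j - m\<close>.\<close>
    define m j where "m = nat (- k)" and "j = nat k"
    have x': "x = (inv U ^^ m) ((U ^^ j) z)"
      by (simp add: x(1) True int_iterate_def m_def j_def)
    \<comment> \<open>The numerator of the sum over the denominator
      \<open>U ^^ (m + n)\<close>.\<close>
    let ?q = "monom c (n + j) + monom 1 m * p"
    have q: "poly_op U ?q z = c *\<^sub>R (U ^^ n) ((U ^^ j) z) + (U ^^ m) (poly_op U p z)"
      by (simp add: poly_op_add[OF linear] poly_op_mult[OF linear] poly_op_monom[OF linear]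
          funpow_add)
    have 1: "(inv U ^^ (m + n)) ((U ^^ n) v) = (inv U ^^ m) v" for v
      by (simp add: funpow_add)
    have 2: "(inv U ^^ (m + n)) ((U ^^ m) v) = (inv U ^^ n) v" for v
      by (subst add.commute) (simp add: funpow_add)
    have "(inv U ^^ (m + n)) (poly_op U ?q z) = c *\<^sub>R x + (inv U ^^ n) (poly_op U p z)"
      unfolding q linear_add[OF lin] linear_scale[OF lin] 1 2 x' ..
    then have "c *\<^sub>R x + y = (inv U ^^ (m + n)) (poly_op U ?q z) + w" using y by simp
    then show ?thesis using y(1) by blast
  next
    case False
    then have "x \<in> span {int_iterate U k x |k x. x \<in> F}" using x by (intro span_base) auto
    then have "x \<in> orbit_span U F" unfolding orbit_span_def by (meson closure_subset subsetD)
    then have "c *\<^sub>R x + w \<in> orbit_span U F"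
      using y(1) subspace_orbit_span by (simp add: subspace_add subspace_scale)
    moreover have "c *\<^sub>R x + y = (inv U ^^ n) (poly_op U p z) + (c *\<^sub>R x + w)" using y by simp
    ultimately show ?thesis by blast
  qed
qed

lemma orbit_span_insert_approx:
  assumes "y \<in> orbit_span U (insert z F)" "0 < e"
  shows "\<exists>T. \<exists>w\<in>orbit_span U F. unit_limit U T \<and> norm (T z + w - y) < e"
proof -
  obtain y' where y': "y' \<in> span {int_iterate U k x |k x. x \<in> insert z F}" "dist y' y < e"
    using assms unfolding orbit_span_def closure_approachable by blast
  obtain n p w where w: "w \<in> orbit_span U F" "y' = (inv U ^^ n) (poly_op U p z) + w"
    using span_orbits_insert[OF y'(1)] by blast
  have "unit_limit U (\<lambda>x. (inv U ^^ n) (poly_op U p x))"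
    by (rule unit_limit_compose[OF unit_preserver_imp_limit[OF unit_preserver_inv_funpow]
          unit_limit_poly_op])
  moreover have "norm ((inv U ^^ n) (poly_op U p z) + w - y) < e"
    using y'(2) w(2) by (simp add: dist_norm)
  ultimately show ?thesis using w(1) by blast
qed

text \<open>Gaussian elimination: the last generator \<open>z q\<close> enters \<open>x q\<close> through an operator that may be
  perturbed to an invertible one. Then \<open>z q\<close> can be expressed by the new \<open>y q\<close> and the remaining
  generators, so eliminating it leaves \<open>q\<close> vectors in the span of \<open>q\<close> generators.\<close>

lemma approx_generators:
  fixes x z :: "nat \<Rightarrow> 'b"
  assumes "0 < e" "\<And>i. i < q \<Longrightarrow> x i \<in> orbit_span U (z ` {..<q})"
  shows "\<exists>y. (\<forall>i<q. norm (y i - x i) < e) \<and> orbit_span U (z ` {..<q}) \<subseteq> orbit_span U (y ` {..<q})"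
  using assms
proof (induction q arbitrary: x e)
  case 0
  then show ?case by auto
next
  case (Suc q)
  let ?V = "orbit_span U (z ` {..<q})"
  have e2: "0 < e / 2" using Suc.prems by simp
  have ins: "z ` {..<Suc q} = insert (z q) (z ` {..<q})" by (simp add: lessThan_Suc)
  have "\<forall>i. \<exists>T w. i < Suc q \<longrightarrow> w \<in> ?V \<and> unit_limit U T \<and> norm (T (z q) + w - x i) < e / 2"
    using orbit_span_insert_approx[OF _ e2] Suc.prems(2) unfolding ins by metis
  then obtain T w where Tw: "\<And>i. i < Suc q \<Longrightarrow> w i \<in> ?V" "\<And>i. i < Suc q \<Longrightarrow> unit_limit U (T i)"
      "\<And>i. i < Suc q \<Longrightarrow> norm (T i (z q) + w i - x i) < e / 2"
    by metis
  have T: "preserver U (T i)" if "i < Suc q" for i using Tw(2)[OF that] by (simp add: unit_limit_def)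
  \<comment> \<open>Only the pivot \<open>T q\<close> is replaced by an invertible operator; the
    other \<open>T i\<close> stay as they are.\<close>
  obtain A where A: "unit_preserver U A" "norm (A (z q) - T q (z q)) < e / 2"
    using Tw(2)[of q] e2 unfolding unit_limit_def by (meson lessI)
  define yq where "yq = A (z q) + w q"
  have yq: "norm (yq - x q) < e"
    using norm_triangle_lt[of "A (z q) - T q (z q)" "T q (z q) + w q - x q" e] A(2) Tw(3)[of q]
    by (simp add: yq_def add_diff_eq)
  \<comment> \<open>Pulling \<open>yq = A (z q) + w q\<close> back through \<open>A\<close> gives
    \<open>z q = u - v\<close>, with \<open>u\<close> generated by \<open>yq\<close> alone and
    \<open>v\<close> by the remaining generators.\<close>
  have "yq \<in> A ` orbit_span U {yq}" "w q \<in> A ` ?V"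
    using A(1) reducing_orbit_span orbit_span_superset[of "{yq}"] Tw(1)[of q]
    by (auto simp: unit_preserver_def)
  then obtain u v where u: "u \<in> orbit_span U {yq}" "A u = yq" and v: "v \<in> ?V" "A v = w q"
    by (metis imageE)
  have "inj A" using A(1) by (simp add: unit_preserver_def)
  have "A (z q + v) = A u"
    by (simp add: linear_add[OF linear_unit_preserver[OF A(1)]] u v yq_def[symmetric])
  with \<open>inj A\<close> have zq: "z q = u - v" by (simp add: inj_eq eq_diff_eq)
  \<comment> \<open>Substituting \<open>u - v\<close> for \<open>z q\<close> turns
    \<open>T i (z q) + w i\<close> into \<open>T i u + x' i\<close>, where \<open>x' i\<close> no
    longer involves \<open>z q\<close>.\<close>
  define x' where "x' i = w i - T i v" for i
  have "x' i \<in> ?V" if "i < q" for i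
    unfolding x'_def using that
    by (intro subspace_diff[OF subspace_orbit_span Tw(1) preserver_orbit_span[OF T v(1)]]) auto
  from Suc.IH[where x = x', OF e2 this] obtain y' where y': "\<And>i. i < q \<Longrightarrow> norm (y' i - x' i) < e / 2"
      "?V \<subseteq> orbit_span U (y' ` {..<q})" by blast
  \<comment> \<open>The part \<open>T i u\<close> is restored exactly; being generated by
    \<open>yq\<close>, it can be subtracted again to recover \<open>y' i\<close>.\<close>
  define y where "y i = (if i = q then yq else T i u + y' i)" for i
  let ?Y = "orbit_span U (y ` {..<Suc q})"
  have yY: "y i \<in> ?Y" if "i < Suc q" for i
    using that by (intro subsetD[OF orbit_span_superset] imageI) simp
  have "orbit_span U {yq} \<subseteq> ?Y" using yY[of q] by (intro orbit_span_subset) (simp add: y_def)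
  with u have uY: "u \<in> ?Y" by blast
  have "y' i \<in> ?Y" if "i < q" for i
  proof -
    have "y i - T i u \<in> ?Y"
      using that
      by (intro subspace_diff[OF subspace_orbit_span yY preserver_orbit_span[OF T uY]]) auto
    then show ?thesis using that by (simp add: y_def)
  qed
  then have "orbit_span U (y' ` {..<q}) \<subseteq> ?Y" by (intro orbit_span_subset) auto
  with y'(2) have VY: "?V \<subseteq> ?Y" by blast
  then have "z q \<in> ?Y" unfolding zq using v(1) by (intro subspace_diff[OF subspace_orbit_span uY]) blast
  moreover have "z ` {..<q} \<subseteq> ?Y" using orbit_span_superset VY by (rule subset_trans)
  ultimately have "orbit_span U (z ` {..<Suc q}) \<subseteq> ?Y"
    unfolding ins by (intro orbit_span_subset) auto
  moreover have "norm (y i - x i) < e" if "i < Suc q" for i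
  proof (cases "i = q")
    case True
    then show ?thesis using yq by (simp add: y_def)
  next
    case False
    with that have i: "i < q" by simp
    have "T i (z q) = T i u - T i v"
      unfolding zq by (rule linear_diff[OF linear_preserver[OF T[OF that]]])
    then have eq: "y i - x i = (y' i - x' i) + (T i (z q) + w i - x i)"
      using False by (simp add: y_def x'_def)
    show ?thesis
      unfolding eq by (rule norm_triangle_lt) (use y'(1)[OF i] Tw(3)[OF that] in linarith)
  qed
  ultimately show ?case by blast
qed

section \<open>Open dense sets of tuples\<close>

text \<open>An element of a closure need not vary continuously with the tuple, so \<open>g\<close>
  is replaced by a finite combination \<open>h\<close> of orbit points. The same combination
  \<open>\<Phi> y\<close> formed from another tuple \<open>y\<close> is continuous in
  \<open>y\<close>.\<close>

lemma open_approximating_tuples: "open {x :: nat \<Rightarrow> 'b. \<exists>g\<in>orbit_span U (x ` {..<q}). norm (g - f) < e}"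
proof (subst open_subopen, intro ballI)
  fix x :: "nat \<Rightarrow> 'b"
  assume "x \<in> {x. \<exists>g\<in>orbit_span U (x ` {..<q}). norm (g - f) < e}"
  then obtain g where g: "g \<in> orbit_span U (x ` {..<q})" "norm (g - f) < e" by blast
  then obtain h where h: "h \<in> span {int_iterate U k y |k y. y \<in> x ` {..<q}}"
      "dist h g < e - norm (g - f)"
    unfolding orbit_span_def closure_approachable by (meson diff_gt_0_iff_gt)
  have hf: "norm (h - f) < e"
    using h(2) norm_triangle_lt[of "h - g" "g - f" e] by (simp add: dist_norm)
  have "\<exists>\<Phi> :: (nat \<Rightarrow> 'b) \<Rightarrow> 'b. continuous_on UNIV \<Phi> \<and> \<Phi> x = h \<and> (\<forall>y. \<Phi> y \<in> orbit_span U (y ` {..<q}))"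
    using h(1)
  proof (induction rule: span_induct_alt)
    case base
    show ?case
      by (intro exI[of _ "\<lambda>_. 0"]) (auto simp: subspace_0 subspace_orbit_span)
  next
    case (step c v h)
    obtain \<Phi> where \<Phi>: "continuous_on UNIV \<Phi>" "\<Phi> x = h" "\<And>y. \<Phi> y \<in> orbit_span U (y ` {..<q})"
      using step by blast
    obtain k i where i: "v = int_iterate U k (x i)" "i < q" using step by blast
    have unit: "unit_preserver U (int_iterate U k)"
      by (auto simp: int_iterate_def unit_preserver_funpow unit_preserver_inv_funpow)
    then have "continuous_on UNIV (int_iterate U k)"
      by (simp add: unit_preserver_def linear_continuous_on)
    then have "continuous_on UNIV (\<lambda>y :: nat \<Rightarrow> 'b. int_iterate U k (y i))"
      by (rule continuous_on_compose2) (auto intro: continuous_on_product_coordinates)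
    then have "continuous_on UNIV (\<lambda>y. c *\<^sub>R int_iterate U k (y i) + \<Phi> y)"
      by (intro continuous_intros \<Phi>(1))
    moreover have "c *\<^sub>R int_iterate U k (y i) + \<Phi> y \<in> orbit_span U (y ` {..<q})" for y
      using i(2) orbit_span_superset[of "y ` {..<q}"]
      by (intro subspace_add subspace_scale subspace_orbit_span \<Phi>(3)
          preserver_orbit_span[OF unit_preserver_imp_preserver[OF unit]]) auto
    ultimately show ?case
      using i(1) \<Phi>(2) by (intro exI[of _ "\<lambda>y. c *\<^sub>R int_iterate U k (y i) + \<Phi> y"]) auto
  qed
  then obtain \<Phi> :: "(nat \<Rightarrow> 'b) \<Rightarrow> 'b" where \<Phi>: "continuous_on UNIV \<Phi>" "\<Phi> x = h"
      "\<And>y. \<Phi> y \<in> orbit_span U (y ` {..<q})" by blast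
  have "open (\<Phi> -` ball f e)" using \<Phi>(1) by (simp add: open_vimage)
  moreover have "x \<in> \<Phi> -` ball f e" using hf \<Phi>(2) by (simp add: dist_norm norm_minus_commute)
  moreover have "\<Phi> -` ball f e \<subseteq> {x. \<exists>g\<in>orbit_span U (x ` {..<q}). norm (g - f) < e}"
    using \<Phi>(3) by (auto simp: dist_norm norm_minus_commute)
  ultimately show "\<exists>T. open T \<and> x \<in> T \<and> T \<subseteq> {x. \<exists>g\<in>orbit_span U (x ` {..<q}). norm (g - f) < e}"
    by blast
qed

lemma dense_approximating_tuples:
  assumes fin: "\<And>n. finite (Fs n)" and card: "\<And>n. card (Fs n) \<le> q"
    and lim: "\<And>f. (\<lambda>n. INF g\<in>orbit_span U (Fs n). norm (g - f)) \<longlonglongrightarrow> 0"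
    and e: "0 < e"
  shows "closure {x :: nat \<Rightarrow> 'b. \<exists>g\<in>orbit_span U (x ` {..<q}). norm (g - f) < e} = UNIV"
proof -
  define W where "W = {x :: nat \<Rightarrow> 'b. \<exists>g\<in>orbit_span U (x ` {..<q}). norm (g - f) < e}"
  have near: "\<exists>y\<in>W. \<forall>i. norm (y i - x i) < d" if d: "0 < d" for d and x :: "nat \<Rightarrow> 'b"
  proof -
    \<comment> \<open>Half of \<open>d\<close> is left for \<open>approx_generators\<close>; the
      bound \<open>e\<close> serves the target \<open>f\<close>.\<close>
    define r where "r = min (d / 2) e"
    have r: "0 < r" using d e by (simp add: r_def)
    have ev: "\<forall>\<^sub>F n in sequentially. (INF g\<in>orbit_span U (Fs n). norm (g - h)) < r" for h
      using lim r by (rule order_tendstoD(2))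
    \<comment> \<open>There are only finitely many targets, \<open>f\<close> and the first
      \<open>q\<close> entries, so one \<open>n\<close> serves all of them.\<close>
    have "\<forall>\<^sub>F n in sequentially. (INF g\<in>orbit_span U (Fs n). norm (g - f)) < r \<and>
        (\<forall>i\<in>{..<q}. (INF g\<in>orbit_span U (Fs n). norm (g - x i)) < r)"
      by (intro eventually_conj ev eventually_ball_finite) (auto intro: ev)
    then obtain n where n: "(INF g\<in>orbit_span U (Fs n). norm (g - f)) < r"
        "\<And>i. i < q \<Longrightarrow> (INF g\<in>orbit_span U (Fs n). norm (g - x i)) < r"
      unfolding eventually_sequentially by blast
    have ne: "orbit_span U (Fs n) \<noteq> {}" using subspace_0[OF subspace_orbit_span] by blast
    have app: "\<exists>g\<in>orbit_span U (Fs n). norm (g - h) < r"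
      if "(INF g\<in>orbit_span U (Fs n). norm (g - h)) < r" for h
      using that cInf_lessD[of "(\<lambda>g. norm (g - h)) ` orbit_span U (Fs n)" r] ne by blast
    obtain g where g: "g \<in> orbit_span U (Fs n)" "norm (g - f) < r" using app n(1) by blast
    have "\<forall>i. \<exists>g. i < q \<longrightarrow> g \<in> orbit_span U (Fs n) \<and> norm (g - x i) < r"
      using app n(2) by blast
    then obtain x' where x': "\<And>i. i < q \<Longrightarrow> x' i \<in> orbit_span U (Fs n) \<and> norm (x' i - x i) < r"
      by metis
    obtain z :: "nat \<Rightarrow> 'b" where z: "Fs n = z ` {..<card (Fs n)}"
      using ex_bij_betw_nat_finite[OF fin] by (metis atLeast0LessThan bij_betw_imp_surj_on)
    \<comment> \<open>If \<open>Fs n\<close> has fewer than \<open>q\<close> elements, the surplus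
      entries of \<open>z\<close> are arbitrary and can only enlarge the span.\<close>
    have "Fs n \<subseteq> z ` {..<q}" using card[of n] by (subst z) auto
    then have sub: "orbit_span U (Fs n) \<subseteq> orbit_span U (z ` {..<q})"
      using orbit_span_superset by (intro orbit_span_subset) blast
    have d2: "0 < d / 2" using d by simp
    have "x' i \<in> orbit_span U (z ` {..<q})" if "i < q" for i using x'[OF that] sub by blast
    from approx_generators[where x = x' and z = z and q = q, OF d2 this] obtain y where
      y: "\<And>i. i < q \<Longrightarrow> norm (y i - x' i) < d / 2"
        "orbit_span U (z ` {..<q}) \<subseteq> orbit_span U (y ` {..<q})" by blast
    define y' where "y' i = (if i < q then y i else x i)" for i
    have im: "y' ` {..<q} = y ` {..<q}" by (auto simp: y'_def)
    have "norm (y' i - x i) < d" for i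
    proof (cases "i < q")
      case True
      then show ?thesis
        using norm_triangle_lt[of "y i - x' i" "x' i - x i" d] y(1)[OF True] x'[OF True]
        by (simp add: y'_def r_def)
    qed (use d in \<open>simp add: y'_def\<close>)
    moreover have "y' \<in> W" using g sub y(2) unfolding im[symmetric] by (force simp: r_def W_def)
    ultimately show ?thesis by blast
  qed
  have "x \<in> closure W" for x
  proof -
    have "\<forall>n. \<exists>y\<in>W. \<forall>i. norm (y i - x i) < inverse (Suc n)" using near by simp
    then obtain Y where Y: "\<And>n. Y n \<in> W" "\<And>n i. norm (Y n i - x i) < inverse (Suc n)" by metis
    have "(\<lambda>n. Y n i) \<longlonglongrightarrow> x i" for i
    proof -
      have "(\<lambda>n. Y n i - x i) \<longlonglongrightarrow> 0"
        by (rule Lim_null_comparison[OF _ LIMSEQ_inverse_real_of_nat])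
          (intro always_eventually allI less_imp_le Y(2))
      then show ?thesis by (simp add: LIM_zero_iff)
    qed
    \<comment> \<open>Convergence in the product topology is coordinatewise.\<close>
    then have "Y \<longlonglongrightarrow> x"
      using limitin_componentwise[of "\<lambda>_. euclidean" UNIV Y x sequentially]
      by (simp add: euclidean_product_topology)
    then show ?thesis using Y(1) unfolding closure_sequential by blast
  qed
  then show ?thesis unfolding W_def by blast
qed

end

section \<open>The Baire category argument\<close>

theorem lemma4p1:
  fixes U :: "'b::banach \<Rightarrow> 'b"
    and Fs :: "nat \<Rightarrow> 'b set"
  assumes "separable_space (euclidean :: 'b topology)"
    and "linear U" and "bij U" and "\<And>x. norm (U x) = norm x"
    and "\<And>n. finite (Fs n)"
    and "\<And>f. (\<lambda>n. INF g\<in>orbit_span U (Fs n). norm (g - f)) \<longlonglongrightarrow> 0"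
  shows "\<exists>F::'b set. ecard F \<le> (SUP n. ecard (Fs n)) \<and> orbit_span U F = UNIV"
proof -
  interpret invertible_isometry U
    by (rule invertible_isometry.intro[OF assms(2-4)])
  show ?thesis
  proof (cases "SUP n. ecard (Fs n)")
    case infinity
    then show ?thesis using orbit_span_superset[of UNIV] by (intro exI[of _ UNIV]) auto
  next
    case (enat q)
    have "ecard (Fs n) \<le> enat q" for n by (metis SUP_upper UNIV_I enat)
    then have card: "card (Fs n) \<le> q" for n using assms(5) by (simp add: ecard_def)
    obtain C :: "'b set" where C: "countable C" "closure C = UNIV"
      using assms(1) by (auto simp: separable_space_def)
    \<comment> \<open>Countably many conditions suffice: \<open>f\<close> runs through a countable
      dense set and the tolerance through \<open>1 / Suc m\<close>.\<close>
    define O' where "O' f m = {x :: nat \<Rightarrow> 'b. \<exists>g\<in>orbit_span U (x ` {..<q}). norm (g - f) < 1 / Suc m}"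
      for f m
    define \<G> where "\<G> = (\<lambda>(f, m). O' f m) ` (C \<times> UNIV)"
    have "(euclidean :: (nat \<Rightarrow> 'b) topology) closure_of \<Inter>\<G> = topspace euclidean"
    proof (rule Baire_category)
      show "completely_metrizable_space (euclidean :: (nat \<Rightarrow> 'b) topology) \<or>
          locally_compact_space (euclidean :: (nat \<Rightarrow> 'b) topology) \<and>
          regular_space (euclidean :: (nat \<Rightarrow> 'b) topology)"
        using completely_metrizable_space_euclidean by blast
      show "countable \<G>" unfolding \<G>_def using C(1) by simp
      show "openin euclidean T \<and> euclidean closure_of T = topspace euclidean" if "T \<in> \<G>" for T
        using that open_approximating_tuples dense_approximating_tuples[OF assms(5) card assms(6)]
        by (auto simp: \<G>_def O'_def)
    qed
    \<comment> \<open>A dense subset of a nonempty space is nonempty; any of its points gives the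
      generators.\<close>
    then have "\<Inter>\<G> \<noteq> {}" by auto
    then obtain x where x: "\<And>f m. f \<in> C \<Longrightarrow> x \<in> O' f m" by (auto simp: \<G>_def)
    let ?F = "x ` {..<q}"
    have "f \<in> orbit_span U ?F" if "f \<in> C" for f
    proof -
      have "\<exists>g\<in>orbit_span U ?F. dist g f < e" if "0 < e" for e
      proof -
        obtain m where "1 / Suc m < e" using nat_approx_posE[OF \<open>0 < e\<close>] by blast
        moreover obtain g where "g \<in> orbit_span U ?F" "norm (g - f) < 1 / Suc m"
          using x[OF \<open>f \<in> C\<close>, of m] by (auto simp: O'_def)
        ultimately show ?thesis by (metis dist_norm less_trans)
      qed
      then have "f \<in> closure (orbit_span U ?F)" by (simp add: closure_approachable)
      then show ?thesis by (simp add: orbit_span_def)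
    qed
    then have "closure C \<subseteq> orbit_span U ?F"
      by (intro closure_minimal) (auto simp: orbit_span_def)
    then have "orbit_span U ?F = UNIV" using C(2) by auto
    \<comment> \<open>Entries of \<open>x\<close> may coincide, so only an inequality holds.\<close>
    moreover have "ecard ?F \<le> enat q"
      using card_image_le[of "{..<q}" x] by (simp add: ecard_def)
    ultimately show ?thesis unfolding enat by blast
  qed
qed

end
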